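(* Let $a<b$ be real numbers, let $f:[a,b]\to\mathbb{R}$ be bounded, let $g:[a,b]\to\mathbb{R}$ be Riemann integrable, let $c\in\mathbb{R}$, and let $G(x)=c+\int_a^x g(y)\,dy$ for $x\in[a,b]$. Then $f$ is Riemann--Stieltjes integrable with respect to $G$ over $[a,b]$ if and only if the product $fg$ is Riemann integrable over $[a,b]$, and in that case $$\int_a^b f(x)\,dG(x)=\int_a^b f(x)g(x)\,dx.$$
   Context: Integrals $\int\cdots dx$ and $\int\cdots dy$ are Riemann integrals. The norm of a partition $a=x_0<x_1<\dots<x_n=b$ is $\max_{1\le k\le n}(x_k-x_{k-1})$. For functions $u,v:[a,b]\to\mathbb{R}$, $u$ is Riemann--Stieltjes integrable with respect to $v$ over $[a,b]$, with integral $\int_a^b u(x)\,dv(x)=I\in\mathbb{R}$, if for every $\varepsilon>0$ there is $\delta>0$ such that for every partition $a=x_0<x_1<\dots<x_n=b$ of norm less than $\delta$ and all choices of points $y_k\in[x_{k-1},x_k]$ ($k=1,\dots,n$) one has $\left|\sum_{k=1}^n u(y_k)[v(x_k)-v(x_{k-1})]-I\right|<\varepsilon$. Functions are not assumed Lebesgue measurable unless stated. *)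

theory Defs
  imports "HOL-Analysis.Analysis"
begin

text \<open>
  A partition \<open>a = x 0 < x 1 < \<dots> < x n = b\<close> is given by the number \<open>n\<close> of subintervals and a
  sequence \<open>x\<close> of which only \<open>x 0, \<dots>, x n\<close> matter. For \<open>a = b\<close> the only partition has \<open>n = 0\<close>, so
  that integrals over a degenerate interval are \<open>0\<close>.
\<close>

definition partition :: "real \<Rightarrow> real \<Rightarrow> nat \<Rightarrow> (nat \<Rightarrow> real) \<Rightarrow> bool" where
  "partition a b n x \<longleftrightarrow> x 0 = a \<and> x n = b \<and> (\<forall>k\<in>{1..n}. x (k - 1) < x k)"

text \<open>
  The differences are positive for a partition, so the inserted \<open>0\<close> only serves to give the maximum
  a value when \<open>n = 0\<close>.
\<close>

definition partition_norm :: "nat \<Rightarrow> (nat \<Rightarrow> real) \<Rightarrow> real" where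
  "partition_norm n x = Max (insert 0 ((\<lambda>k. x k - x (k - 1)) ` {1..n}))"

definition has_RS_integral ::
  "(real \<Rightarrow> real) \<Rightarrow> (real \<Rightarrow> real) \<Rightarrow> real \<Rightarrow> real \<Rightarrow> real \<Rightarrow> bool" where
  "has_RS_integral u v a b I \<longleftrightarrow>
     (\<forall>\<epsilon>>0. \<exists>\<delta>>0. \<forall>n x y.
        partition a b n x \<and> partition_norm n x < \<delta> \<and> (\<forall>k\<in>{1..n}. y k \<in> {x (k - 1)..x k}) \<longrightarrow>
        \<bar>(\<Sum>k=1..n. u (y k) * (v (x k) - v (x (k - 1)))) - I\<bar> < \<epsilon>)"

definition RS_integrable :: "(real \<Rightarrow> real) \<Rightarrow> (real \<Rightarrow> real) \<Rightarrow> real \<Rightarrow> real \<Rightarrow> bool" where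
  "RS_integrable u v a b \<longleftrightarrow> (\<exists>I. has_RS_integral u v a b I)"

definition RS_integral :: "(real \<Rightarrow> real) \<Rightarrow> (real \<Rightarrow> real) \<Rightarrow> real \<Rightarrow> real \<Rightarrow> real" where
  "RS_integral u v a b = (THE I. has_RS_integral u v a b I)"

text \<open>With the identity as integrator, the sums above are the ordinary Riemann sums.\<close>

definition riemann_integrable :: "(real \<Rightarrow> real) \<Rightarrow> real \<Rightarrow> real \<Rightarrow> bool" where
  "riemann_integrable u a b \<longleftrightarrow> RS_integrable u (\<lambda>x. x) a b"

definition riemann_integral :: "(real \<Rightarrow> real) \<Rightarrow> real \<Rightarrow> real \<Rightarrow> real" where
  "riemann_integral u a b = RS_integral u (\<lambda>x. x) a b"

lemma fine_partition_exists:
  assumes "a \<le> b" "\<delta> > 0"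
  shows "\<exists>n x. partition a b n x \<and> partition_norm n x < \<delta>"
proof (cases "a = b")
  case True
  then have "partition a b 0 (\<lambda>_. a) \<and> partition_norm 0 (\<lambda>_. a) < \<delta>"
    using assms by (simp add: partition_def partition_norm_def)
  then show ?thesis by blast
next
  case False
  with assms have ab: "a < b" by simp
  obtain n :: nat where n: "(b - a) / \<delta> < real n"
    using reals_Archimedean2 by blast
  have n0: "real n > 0"
    using n ab assms by (smt (verit) divide_pos_pos)
  define h where "h = (b - a) / real n"
  define x where "x = (\<lambda>k::nat. a + real k * h)"
  have h: "h > 0" "h < \<delta>"
    using n n0 ab assms by (auto simp: h_def field_simps)
  have diff: "x k - x (k - 1) = h" if "k \<in> {1..n}" for k
    using that by (simp add: x_def of_nat_diff algebra_simps)
  have "partition a b n x"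
    unfolding partition_def
  proof (intro conjI ballI)
    show "x 0 = a" by (simp add: x_def)
    show "x n = b" using n0 by (simp add: x_def h_def)
    show "x (k - 1) < x k" if "k \<in> {1..n}" for k
      using diff[OF that] h by linarith
  qed
  moreover have "partition_norm n x < \<delta>"
    unfolding partition_norm_def using diff h assms by (subst Max_less_iff) auto
  ultimately show ?thesis by blast
qed

lemma has_RS_integral_unique:
  assumes "a \<le> b" and I: "has_RS_integral u v a b I" and J: "has_RS_integral u v a b J"
  shows "I = J"
proof (rule ccontr)
  assume "I \<noteq> J"
  define \<epsilon> where "\<epsilon> = \<bar>I - J\<bar> / 2"
  have "\<epsilon> > 0" using \<open>I \<noteq> J\<close> by (simp add: \<epsilon>_def)
  let ?S = "\<lambda>n x y. \<Sum>k=1..n. u (y k) * (v (x k) - v (x (k - 1)))"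
  let ?P = "\<lambda>\<delta> n x y. partition a b n x \<and> partition_norm n x < \<delta> \<and>
    (\<forall>k\<in>{1..n}. y k \<in> {x (k - 1)..x k})"
  obtain d1 where d1: "d1 > 0" "\<And>n x y. ?P d1 n x y \<Longrightarrow> \<bar>?S n x y - I\<bar> < \<epsilon>"
    using I \<open>\<epsilon> > 0\<close> unfolding has_RS_integral_def by blast
  obtain d2 where d2: "d2 > 0" "\<And>n x y. ?P d2 n x y \<Longrightarrow> \<bar>?S n x y - J\<bar> < \<epsilon>"
    using J \<open>\<epsilon> > 0\<close> unfolding has_RS_integral_def by blast
  obtain n x where nx: "partition a b n x" "partition_norm n x < min d1 d2"
    using fine_partition_exists[OF \<open>a \<le> b\<close>, of "min d1 d2"] d1(1) d2(1) by auto
  have tags: "\<forall>k\<in>{1..n}. x k \<in> {x (k - 1)..x k}"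
    using nx(1) by (auto simp: partition_def intro: less_imp_le)
  have "\<bar>?S n x x - I\<bar> < \<epsilon>" "\<bar>?S n x x - J\<bar> < \<epsilon>"
    using d1(2)[of n x x] d2(2)[of n x x] nx tags by auto
  then show False unfolding \<epsilon>_def by (simp add: abs_if field_simps split: if_splits)
qed

lemma RS_integral_unique:
  assumes "a \<le> b" "has_RS_integral u v a b I"
  shows "RS_integral u v a b = I"
  unfolding RS_integral_def using assms has_RS_integral_unique by blast

end

theory Submission
  imports Defs
begin

text \<open>
  If the Riemann sums of \<open>g\<close> over fine partitions are within \<open>\<epsilon>\<close> of the integral, then taking on
  each subinterval the tag with the larger, resp. smaller, value shows \<open>\<Sum>\<bar>g (y k) - g (z k)\<bar> * (x k - x (k - 1)) < 2 * \<epsilon>\<close>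
  for any two systems of tags. Since \<open>G (x k) - G (x (k - 1))\<close> is the integral of \<open>g\<close> over the
  \<open>k\<close>-th subinterval, this bounds \<open>\<Sum>\<bar>g (y k) * (x k - x (k - 1)) - (G (x k) - G (x (k - 1)))\<bar>\<close>.
  As \<open>f\<close> is bounded, the sums defining the two integrals thus differ by a quantity tending to \<open>0\<close>.
\<close>

section \<open>Tagged partitions and their sums\<close>

text \<open>The norm is replaced by a bound on each subinterval, so that joining partitions and
  changing tags can be checked index by index, without a maximum.\<close>

definition fine_tagged ::
  "real \<Rightarrow> real \<Rightarrow> real \<Rightarrow> nat \<Rightarrow> (nat \<Rightarrow> real) \<Rightarrow> (nat \<Rightarrow> real) \<Rightarrow> bool" where
  "fine_tagged \<delta> a b n x y \<longleftrightarrow> partition a b n x \<and> (\<forall>k\<in>{1..n}. x k - x (k - 1) < \<delta>) \<and>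
     (\<forall>k\<in>{1..n}. y k \<in> {x (k - 1)..x k})"

definition RS_sum ::
  "(real \<Rightarrow> real) \<Rightarrow> (real \<Rightarrow> real) \<Rightarrow> nat \<Rightarrow> (nat \<Rightarrow> real) \<Rightarrow> (nat \<Rightarrow> real) \<Rightarrow> real" where
  "RS_sum u v n x y = (\<Sum>k=1..n. u (y k) * (v (x k) - v (x (k - 1))))"

lemma partition_norm_less_iff:
  assumes "\<delta> > 0"
  shows "partition_norm n x < \<delta> \<longleftrightarrow> (\<forall>k\<in>{1..n}. x k - x (k - 1) < \<delta>)"
  unfolding partition_norm_def using assms by (subst Max_less_iff) auto

lemma has_RS_integral_iff:
  "has_RS_integral u v a b I \<longleftrightarrow>
     (\<forall>\<epsilon>>0. \<exists>\<delta>>0. \<forall>n x y. fine_tagged \<delta> a b n x y \<longrightarrow> \<bar>RS_sum u v n x y - I\<bar> < \<epsilon>)"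
  unfolding has_RS_integral_def fine_tagged_def RS_sum_def
  \<comment> \<open>The congruence rule supplies \<open>\<delta> > 0\<close> to
    \<open>partition_norm_less_iff\<close>. Without it the two conditions differ: for
    \<open>n = 0\<close> and \<open>\<delta> \<le> 0\<close> the bound on each subinterval holds
    vacuously, while the norm is \<open>0\<close>.\<close>
  by (simp add: partition_norm_less_iff cong: conj_cong)

lemma has_RS_integralE:
  assumes "has_RS_integral u v a b I" "\<epsilon> > 0"
  obtains \<delta> where "\<delta> > 0"
    "\<And>n x y. fine_tagged \<delta> a b n x y \<Longrightarrow> \<bar>RS_sum u v n x y - I\<bar> < \<epsilon>"
  using assms unfolding has_RS_integral_iff by blast

lemma fine_tagged_exists:
  assumes "a \<le> b" "\<delta> > 0"
  obtains n x y where "fine_tagged \<delta> a b n x y"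
proof -
  obtain n x where "partition a b n x" "partition_norm n x < \<delta>"
    using fine_partition_exists[OF assms] by blast
  then have "fine_tagged \<delta> a b n x x"
    using assms by (auto simp: fine_tagged_def partition_norm_less_iff partition_def intro: less_imp_le)
  then show ?thesis by (rule that)
qed

lemma fine_tagged_mono: "fine_tagged \<delta> a b n x y \<Longrightarrow> \<delta> \<le> \<delta>' \<Longrightarrow> fine_tagged \<delta>' a b n x y"
  unfolding fine_tagged_def by force

lemma partition_mono:
  assumes "partition a b n x" "i \<le> j" "j \<le> n"
  shows "x i \<le> x j"
  using assms(2,3)
proof (induction j rule: dec_induct)
  case (step j)
  have "Suc j \<in> {1..n}" using step.prems by simp
  then have "x (Suc j - 1) < x (Suc j)"
    using assms(1) unfolding partition_def by blast
  with step show ?case by simp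
qed simp

lemma partition_in_interval:
  assumes "partition a b n x" "k \<le> n"
  shows "x k \<in> {a..b}"
  using partition_mono[OF assms(1), of 0 k] partition_mono[OF assms(1), of k n] assms
  by (simp add: partition_def)

lemma fine_tagged_tag_in_interval:
  assumes "fine_tagged \<delta> a b n x y" "k \<in> {1..n}"
  shows "y k \<in> {a..b}"
proof -
  have "partition a b n x" "y k \<in> {x (k - 1)..x k}"
    using assms by (auto simp: fine_tagged_def)
  moreover have "k \<le> n" "k - 1 \<le> n"
    using assms(2) by auto
  ultimately show ?thesis
    using partition_in_interval[of a b n x k] partition_in_interval[of a b n x "k - 1"] by auto
qed

lemma sum_partition_diff:
  assumes "partition a b n x"
  shows "(\<Sum>k=1..n. v (x k) - v (x (k - 1))) = (v b - v a :: real)"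
proof -
  have "(\<Sum>k=1..m. v (x k) - v (x (k - 1))) = v (x m) - v (x 0)" for m
    by (induction m) auto
  then show ?thesis
    using assms by (simp add: partition_def)
qed

section \<open>Joining partitions of adjacent intervals\<close>

text \<open>One operation serves for division points and for tags. Index \<open>n\<close> belongs to
  the left sequence, so index \<open>0\<close> of the right one is dropped: as a division point it
  repeats the common endpoint, and tags are only read from index \<open>1\<close> on.\<close>

definition join :: "nat \<Rightarrow> (nat \<Rightarrow> real) \<Rightarrow> (nat \<Rightarrow> real) \<Rightarrow> nat \<Rightarrow> real" where
  "join n x x' k = (if k \<le> n then x k else x' (k - n))"

lemma
  assumes 1: "fine_tagged \<delta> a c n x y" and 2: "fine_tagged \<delta> c b m x' y'"
  shows fine_tagged_join: "fine_tagged \<delta> a b (n + m) (join n x x') (join n y y')"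
    and RS_sum_join:
      "RS_sum u v (n + m) (join n x x') (join n y y') = RS_sum u v n x y + RS_sum u v m x' y'"
proof -
  have c: "x n = c" "x' 0 = c"
    using 1 2 by (auto simp: fine_tagged_def partition_def)
  have left: "join n x x' k = x k" "join n x x' (k - 1) = x (k - 1)" "join n y y' k = y k"
    if "k \<in> {1..n}" for k
    using that by (auto simp: join_def)
  \<comment> \<open>For \<open>k = 1\<close> the left endpoint comes from the first sequence, as
    \<open>x n = c = x' 0\<close>; this is the case that needs the two partitions to meet.\<close>
  have right: "join n x x' (k + n) = x' k" "join n x x' (k + n - 1) = x' (k - 1)"
    "join n y y' (k + n) = y' k" if "k \<in> {1..m}" for k
    using that c by (cases k; simp add: join_def)+
  have split: "{1..n + m} = {1..n} \<union> (\<lambda>k. k + n) ` {1..m}"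
    by (auto simp: image_add_atLeastAtMost' simp del: image_add_atLeastAtMost)
  have "join n x x' 0 = a" "join n x x' (n + m) = b"
    using 1 2 c by (auto simp: fine_tagged_def partition_def join_def)
  then show "fine_tagged \<delta> a b (n + m) (join n x x') (join n y y')"
    using 1 2 unfolding fine_tagged_def partition_def split ball_Un ball_simps
    by (simp add: left right del: One_nat_def)
  have "RS_sum u v (n + m) (join n x x') (join n y y') =
      (\<Sum>k=1..n. u (join n y y' k) * (v (join n x x' k) - v (join n x x' (k - 1)))) +
      (\<Sum>k\<in>(\<lambda>k. k + n) ` {1..m}. u (join n y y' k) * (v (join n x x' k) - v (join n x x' (k - 1))))"
    unfolding RS_sum_def split by (rule sum.union_disjoint) auto
  also have "\<dots> = RS_sum u v n x y + RS_sum u v m x' y'"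
    unfolding RS_sum_def by (subst sum.reindex) (simp_all add: left right del: One_nat_def)
  finally show "RS_sum u v (n + m) (join n x x') (join n y y') =
    RS_sum u v n x y + RS_sum u v m x' y'" .
qed

section \<open>Cauchy criterion, subintervals and additivity\<close>

text \<open>This gives integrability without a candidate for the value, as needed on subintervals.
  The sums over tagged partitions of mesh below \<open>1 / (i + 1)\<close> form a Cauchy sequence,
  and its limit is the integral.\<close>

lemma RS_integrable_Cauchy:
  assumes "a \<le> b"
    and cauchy: "\<And>\<epsilon>. \<epsilon> > 0 \<Longrightarrow> \<exists>\<delta>>0. \<forall>n x y m x' y'.
      fine_tagged \<delta> a b n x y \<longrightarrow> fine_tagged \<delta> a b m x' y' \<longrightarrow>
      \<bar>RS_sum u v n x y - RS_sum u v m x' y'\<bar> < \<epsilon>"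
  shows "RS_integrable u v a b"
proof -
  have "\<exists>n x y. fine_tagged (inverse (real (Suc i))) a b n x y" for i
    using fine_tagged_exists[OF \<open>a \<le> b\<close>, of "inverse (real (Suc i))"] by (metis inverse_Suc)
  then obtain n x y where nxy: "\<And>i. fine_tagged (inverse (real (Suc i))) a b (n i) (x i) (y i)"
    by metis
  define s where "s i = RS_sum u v (n i) (x i) (y i)" for i
  have fine: "\<exists>N. \<forall>i\<ge>N. fine_tagged \<delta> a b (n i) (x i) (y i)" if "\<delta> > 0" for \<delta>
  proof -
    obtain N where N: "inverse (real (Suc N)) < \<delta>"
      using reals_Archimedean[OF \<open>\<delta> > 0\<close>] by blast
    have "inverse (real (Suc i)) \<le> \<delta>" if "i \<ge> N" for i
    proof -
      have "inverse (real (Suc i)) \<le> inverse (real (Suc N))"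
        using that by (intro le_imp_inverse_le) auto
      with N show ?thesis by linarith
    qed
    then show ?thesis
      using fine_tagged_mono[OF nxy] by blast
  qed
  have "Cauchy s"
    unfolding Cauchy_def dist_real_def s_def using cauchy fine by meson
  then obtain I where I: "s \<longlonglongrightarrow> I"
    using Cauchy_convergent convergent_def by blast
  have "has_RS_integral u v a b I"
    unfolding has_RS_integral_iff
  proof (intro allI impI)
    fix \<epsilon> :: real assume "\<epsilon> > 0"
    then obtain \<delta> where \<delta>: "\<delta> > 0" "\<And>n x y m x' y'.
      fine_tagged \<delta> a b n x y \<Longrightarrow> fine_tagged \<delta> a b m x' y' \<Longrightarrow>
      \<bar>RS_sum u v n x y - RS_sum u v m x' y'\<bar> < \<epsilon> / 2"
      using cauchy[of "\<epsilon> / 2"] by auto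
    obtain N where N: "\<And>i. i \<ge> N \<Longrightarrow> fine_tagged \<delta> a b (n i) (x i) (y i)"
      using fine[OF \<delta>(1)] by blast
    obtain N' where N': "\<And>i. i \<ge> N' \<Longrightarrow> \<bar>s i - I\<bar> < \<epsilon> / 2"
      using LIMSEQ_D[OF I, of "\<epsilon> / 2"] \<open>\<epsilon> > 0\<close> by auto
    \<comment> \<open>The sum \<open>s (max N N')\<close> is the intermediary: it is within
      \<open>\<epsilon> / 2\<close> of the given sum and of \<open>I\<close>.\<close>
    have "\<bar>RS_sum u v m x' y' - I\<bar> < \<epsilon>" if "fine_tagged \<delta> a b m x' y'" for m x' y'
      using \<delta>(2)[OF that N[OF max.cobounded1[of N N']]] N'[OF max.cobounded2[of N' N]]
      unfolding s_def by linarith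
    then show "\<exists>\<delta>>0. \<forall>n x y. fine_tagged \<delta> a b n x y \<longrightarrow> \<bar>RS_sum u v n x y - I\<bar> < \<epsilon>"
      using \<delta>(1) by blast
  qed
  then show ?thesis
    unfolding RS_integrable_def by blast
qed

text \<open>Two fine tagged partitions of the left part are completed by the same one of the right
  part. The two completed sums are both close to \<open>I\<close>, and the common contribution
  cancels in their difference.\<close>

lemma RS_integrable_left:
  assumes "RS_integrable u v a b" "a \<le> c" "c \<le> b"
  shows "RS_integrable u v a c"
proof (rule RS_integrable_Cauchy[OF \<open>a \<le> c\<close>])
  fix \<epsilon> :: real assume "\<epsilon> > 0"
  obtain I where "has_RS_integral u v a b I"
    using assms(1) by (auto simp: RS_integrable_def)
  then obtain \<delta> where \<delta>: "\<delta> > 0"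
    "\<And>n x y. fine_tagged \<delta> a b n x y \<Longrightarrow> \<bar>RS_sum u v n x y - I\<bar> < \<epsilon> / 2"
    using \<open>\<epsilon> > 0\<close> by (elim has_RS_integralE[where \<epsilon> = "\<epsilon> / 2"]) auto
  obtain l r t where r: "fine_tagged \<delta> c b l r t"
    using fine_tagged_exists[OF \<open>c \<le> b\<close> \<delta>(1)] by blast
  have "\<bar>RS_sum u v n x y - RS_sum u v m x' y'\<bar> < \<epsilon>"
    if "fine_tagged \<delta> a c n x y" "fine_tagged \<delta> a c m x' y'" for n x y m x' y'
    using \<delta>(2)[OF fine_tagged_join[OF that(1) r]] \<delta>(2)[OF fine_tagged_join[OF that(2) r]]
    unfolding RS_sum_join[OF that(1) r] RS_sum_join[OF that(2) r] by linarith
  then show "\<exists>\<delta>>0. \<forall>n x y m x' y'. fine_tagged \<delta> a c n x y \<longrightarrow> fine_tagged \<delta> a c m x' y' \<longrightarrow>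
      \<bar>RS_sum u v n x y - RS_sum u v m x' y'\<bar> < \<epsilon>"
    using \<delta>(1) by blast
qed

lemma RS_integrable_right:
  assumes "RS_integrable u v a b" "a \<le> c" "c \<le> b"
  shows "RS_integrable u v c b"
proof (rule RS_integrable_Cauchy[OF \<open>c \<le> b\<close>])
  fix \<epsilon> :: real assume "\<epsilon> > 0"
  obtain I where "has_RS_integral u v a b I"
    using assms(1) by (auto simp: RS_integrable_def)
  then obtain \<delta> where \<delta>: "\<delta> > 0"
    "\<And>n x y. fine_tagged \<delta> a b n x y \<Longrightarrow> \<bar>RS_sum u v n x y - I\<bar> < \<epsilon> / 2"
    using \<open>\<epsilon> > 0\<close> by (elim has_RS_integralE[where \<epsilon> = "\<epsilon> / 2"]) auto
  obtain l r t where r: "fine_tagged \<delta> a c l r t"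
    using fine_tagged_exists[OF \<open>a \<le> c\<close> \<delta>(1)] by blast
  have "\<bar>RS_sum u v n x y - RS_sum u v m x' y'\<bar> < \<epsilon>"
    if "fine_tagged \<delta> c b n x y" "fine_tagged \<delta> c b m x' y'" for n x y m x' y'
    using \<delta>(2)[OF fine_tagged_join[OF r that(1)]] \<delta>(2)[OF fine_tagged_join[OF r that(2)]]
    unfolding RS_sum_join[OF r that(1)] RS_sum_join[OF r that(2)] by linarith
  then show "\<exists>\<delta>>0. \<forall>n x y m x' y'. fine_tagged \<delta> c b n x y \<longrightarrow> fine_tagged \<delta> c b m x' y' \<longrightarrow>
      \<bar>RS_sum u v n x y - RS_sum u v m x' y'\<bar> < \<epsilon>"
    using \<delta>(1) by blast
qed

lemma has_RS_integral_RS_integral: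
  assumes "RS_integrable u v a b" "a \<le> b"
  shows "has_RS_integral u v a b (RS_integral u v a b)"
  using assms RS_integral_unique unfolding RS_integrable_def by metis

text \<open>All three integrals are known to exist, so it is enough to look at fine partitions of
  the whole interval that have \<open>c\<close> as a division point. Their sums split
  exactly.\<close>

lemma RS_integral_combine:
  assumes "RS_integrable u v a b" "a \<le> c" "c \<le> b"
  shows "RS_integral u v a b = RS_integral u v a c + RS_integral u v c b"
proof (rule ccontr)
  let ?I = "RS_integral u v a b" and ?J = "RS_integral u v a c" and ?K = "RS_integral u v c b"
  assume "?I \<noteq> ?J + ?K"
  \<comment> \<open>A third of the gap: three errors strictly below it cannot add up to the
    gap.\<close>
  then have \<epsilon>: "\<bar>?I - (?J + ?K)\<bar> / 3 > 0" by simp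
  have I: "has_RS_integral u v a b ?I" and J: "has_RS_integral u v a c ?J"
    and K: "has_RS_integral u v c b ?K"
    using assms RS_integrable_left[OF assms] RS_integrable_right[OF assms]
    by (auto intro: has_RS_integral_RS_integral)
  obtain d where d: "d > 0" "\<And>n x y. fine_tagged d a b n x y \<Longrightarrow>
      \<bar>RS_sum u v n x y - ?I\<bar> < \<bar>?I - (?J + ?K)\<bar> / 3"
    using has_RS_integralE[OF I \<epsilon>] by blast
  obtain e where e: "e > 0" "\<And>n x y. fine_tagged e a c n x y \<Longrightarrow>
      \<bar>RS_sum u v n x y - ?J\<bar> < \<bar>?I - (?J + ?K)\<bar> / 3"
    using has_RS_integralE[OF J \<epsilon>] by blast
  obtain h where h: "h > 0" "\<And>n x y. fine_tagged h c b n x y \<Longrightarrow>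
      \<bar>RS_sum u v n x y - ?K\<bar> < \<bar>?I - (?J + ?K)\<bar> / 3"
    using has_RS_integralE[OF K \<epsilon>] by blast
  define \<delta> where "\<delta> = min d (min e h)"
  have \<delta>: "\<delta> > 0" "\<delta> \<le> d" "\<delta> \<le> e" "\<delta> \<le> h"
    using d(1) e(1) h(1) by (auto simp: \<delta>_def)
  obtain n x y where l: "fine_tagged \<delta> a c n x y"
    using fine_tagged_exists[OF \<open>a \<le> c\<close> \<delta>(1)] by blast
  obtain m x' y' where r: "fine_tagged \<delta> c b m x' y'"
    using fine_tagged_exists[OF \<open>c \<le> b\<close> \<delta>(1)] by blast
  have "\<bar>RS_sum u v n x y + RS_sum u v m x' y' - ?I\<bar> < \<bar>?I - (?J + ?K)\<bar> / 3"
    using d(2)[OF fine_tagged_mono[OF fine_tagged_join[OF l r] \<delta>(2)]]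
    by (simp add: RS_sum_join[OF l r])
  moreover note e(2)[OF fine_tagged_mono[OF l \<delta>(3)]] h(2)[OF fine_tagged_mono[OF r \<delta>(4)]]
  ultimately show False by argo
qed

section \<open>Riemann sums against the indefinite integral\<close>

text \<open>Every Riemann sum of \<open>u\<close> obeys this bound, since the lengths add up to
  \<open>b - a\<close>; the integral is approximated by such sums. It will be applied on a single
  subinterval, with the value of \<open>g\<close> at the tag as \<open>L\<close>.\<close>

lemma riemann_integral_approx_const:
  assumes "riemann_integrable u a b" "a \<le> b" "\<And>z. z \<in> {a..b} \<Longrightarrow> \<bar>L - u z\<bar> \<le> B"
  shows "\<bar>L * (b - a) - riemann_integral u a b\<bar> \<le> B * (b - a)"
proof (rule field_le_epsilon)
  fix \<epsilon> :: real assume "\<epsilon> > 0"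
  have "has_RS_integral u (\<lambda>x. x) a b (riemann_integral u a b)"
    using assms has_RS_integral_RS_integral
    by (simp add: riemann_integrable_def riemann_integral_def)
  then obtain \<delta> where \<delta>: "\<delta> > 0" "\<And>n x y. fine_tagged \<delta> a b n x y \<Longrightarrow>
      \<bar>RS_sum u (\<lambda>x. x) n x y - riemann_integral u a b\<bar> < \<epsilon>"
    using \<open>\<epsilon> > 0\<close> has_RS_integralE by blast
  obtain n x y where nxy: "fine_tagged \<delta> a b n x y"
    using fine_tagged_exists[OF \<open>a \<le> b\<close> \<delta>(1)] by blast
  then have p: "partition a b n x" by (simp add: fine_tagged_def)
  have len: "(\<Sum>k=1..n. x k - x (k - 1)) = b - a"
    using sum_partition_diff[OF p, of "\<lambda>x. x"] .
  have "L * (b - a) - RS_sum u (\<lambda>x. x) n x y = (\<Sum>k=1..n. (L - u (y k)) * (x k - x (k - 1)))"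
    unfolding RS_sum_def len[symmetric] sum_distrib_left sum_subtractf[symmetric]
    by (simp add: left_diff_distrib)
  also have "\<bar>\<dots>\<bar> \<le> (\<Sum>k=1..n. B * (x k - x (k - 1)))"
  proof (rule order_trans[OF sum_abs], rule sum_mono)
    fix k assume k: "k \<in> {1..n}"
    then have "x (k - 1) < x k" using p by (simp add: partition_def)
    then show "\<bar>(L - u (y k)) * (x k - x (k - 1))\<bar> \<le> B * (x k - x (k - 1))"
      using assms(3)[OF fine_tagged_tag_in_interval[OF nxy k]]
      by (simp add: abs_mult mult_right_mono)
  qed
  also have "\<dots> = B * (b - a)"
    unfolding sum_distrib_left[symmetric] len ..
  finally show "\<bar>L * (b - a) - riemann_integral u a b\<bar> \<le> B * (b - a) + \<epsilon>"
    using \<delta>(2)[OF nxy] by linarith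
qed

text \<open>Integrability controls only signed sums. The absolute values can enter because tags may
  be exchanged between the two systems on each subinterval separately.\<close>

lemma riemann_integrable_oscillation:
  assumes "riemann_integrable g a b" "\<epsilon> > 0"
  obtains \<delta> where "\<delta> > 0"
    "\<And>n x y z. fine_tagged \<delta> a b n x y \<Longrightarrow> fine_tagged \<delta> a b n x z \<Longrightarrow>
       (\<Sum>k=1..n. \<bar>g (y k) - g (z k)\<bar> * (x k - x (k - 1))) < \<epsilon>"
proof -
  obtain I where "has_RS_integral g (\<lambda>x. x) a b I"
    using assms(1) by (auto simp: riemann_integrable_def RS_integrable_def)
  then obtain \<delta> where \<delta>: "\<delta> > 0" "\<And>n x y. fine_tagged \<delta> a b n x y \<Longrightarrow>
      \<bar>RS_sum g (\<lambda>x. x) n x y - I\<bar> < \<epsilon> / 2"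
    using \<open>\<epsilon> > 0\<close> by (elim has_RS_integralE[where \<epsilon> = "\<epsilon> / 2"]) auto
  have "(\<Sum>k=1..n. \<bar>g (y k) - g (z k)\<bar> * (x k - x (k - 1))) < \<epsilon>"
    if y: "fine_tagged \<delta> a b n x y" and z: "fine_tagged \<delta> a b n x z" for n x y z
  proof -
    define p where "p k = (if g (y k) \<ge> g (z k) then y k else z k)" for k
    define q where "q k = (if g (y k) \<ge> g (z k) then z k else y k)" for k
    have "fine_tagged \<delta> a b n x p" "fine_tagged \<delta> a b n x q"
      using y z by (auto simp: fine_tagged_def p_def q_def)
    then have "RS_sum g (\<lambda>x. x) n x p - RS_sum g (\<lambda>x. x) n x q < \<epsilon>"
      using \<delta>(2)[of n x p] \<delta>(2)[of n x q] by linarith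
    moreover have "(\<Sum>k=1..n. \<bar>g (y k) - g (z k)\<bar> * (x k - x (k - 1))) =
        RS_sum g (\<lambda>x. x) n x p - RS_sum g (\<lambda>x. x) n x q"
      unfolding RS_sum_def sum_subtractf[symmetric]
      by (intro sum.cong) (auto simp: p_def q_def algebra_simps)
    ultimately show ?thesis by simp
  qed
  with \<delta>(1) show ?thesis by (rule that)
qed

text \<open>The Riemann analogue of Henstock's lemma.\<close>

lemma riemann_sum_indefinite_integral_diff:
  assumes g: "riemann_integrable g a b"
    and G: "\<And>x. x \<in> {a..b} \<Longrightarrow> G x = c + riemann_integral g a x"
    and "\<epsilon> > 0"
  obtains \<delta> where "\<delta> > 0"
    "\<And>n x y. fine_tagged \<delta> a b n x y \<Longrightarrow>
       (\<Sum>k=1..n. \<bar>g (y k) * (x k - x (k - 1)) - (G (x k) - G (x (k - 1)))\<bar>) < \<epsilon>"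
proof -
  \<comment> \<open>Half of \<open>\<epsilon>\<close> makes up for the factor 2 in the choice of the
    tags \<open>z\<close> below.\<close>
  obtain \<delta> where \<delta>: "\<delta> > 0"
    "\<And>n x y z. fine_tagged \<delta> a b n x y \<Longrightarrow> fine_tagged \<delta> a b n x z \<Longrightarrow>
       (\<Sum>k=1..n. \<bar>g (y k) - g (z k)\<bar> * (x k - x (k - 1))) < \<epsilon> / 2"
    using riemann_integrable_oscillation[OF g, of "\<epsilon> / 2"] \<open>\<epsilon> > 0\<close> by auto
  have "(\<Sum>k=1..n. \<bar>g (y k) * (x k - x (k - 1)) - (G (x k) - G (x (k - 1)))\<bar>) < \<epsilon>"
    if y: "fine_tagged \<delta> a b n x y" for n x y
  proof -
    let ?\<Delta> = "\<lambda>k. \<bar>g (y k) * (x k - x (k - 1)) - (G (x k) - G (x (k - 1)))\<bar>"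
    have p: "partition a b n x" using y by (simp add: fine_tagged_def)
    \<comment> \<open>The factor 2 spares us from having to find a tag where a supremum is attained.\<close>
    have "\<exists>z\<in>{x (k - 1)..x k}. ?\<Delta> k \<le> 2 * (\<bar>g (y k) - g z\<bar> * (x k - x (k - 1)))"
      if k: "k \<in> {1..n}" for k
    proof (rule ccontr)
      assume "\<not> ?thesis"
      then have neg: "2 * (\<bar>g (y k) - g z\<bar> * (x k - x (k - 1))) < ?\<Delta> k"
        if "z \<in> {x (k - 1)..x k}" for z
        using that by (auto simp: not_le)
      have lt: "x (k - 1) < x k" using p k by (simp add: partition_def)
      have ab: "a \<le> x (k - 1)" "x k \<le> b" "a \<le> x k" "x (k - 1) \<le> b"
        using partition_in_interval[OF p, of k] partition_in_interval[OF p, of "k - 1"] k by auto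
      have gk: "riemann_integrable g a (x k)"
        using g ab RS_integrable_left unfolding riemann_integrable_def by blast
      then have gk': "riemann_integrable g (x (k - 1)) (x k)"
        using ab lt RS_integrable_right less_imp_le unfolding riemann_integrable_def by blast
      \<comment> \<open>Additivity is used on \<open>[a, x k]\<close>, split at
        \<open>x (k - 1)\<close>; the constant \<open>c\<close> cancels.\<close>
      have dG: "G (x k) - G (x (k - 1)) = riemann_integral g (x (k - 1)) (x k)"
        using RS_integral_combine[of g "\<lambda>x. x" a "x k" "x (k - 1)"] gk ab lt
        by (simp add: G riemann_integral_def riemann_integrable_def)
      \<comment> \<open>On the whole subinterval \<open>g\<close> would be so close to the constant
        \<open>g (y k)\<close> that integration yields
        \<open>?\<Delta> k \<le> ?\<Delta> k / 2\<close>.\<close>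
      have "\<bar>g (y k) - g z\<bar> \<le> ?\<Delta> k / 2 / (x k - x (k - 1))"
        if "z \<in> {x (k - 1)..x k}" for z
        using neg[OF that] lt by (subst pos_le_divide_eq) auto
      then have "?\<Delta> k \<le> ?\<Delta> k / 2 / (x k - x (k - 1)) * (x k - x (k - 1))"
        unfolding dG by (rule riemann_integral_approx_const[OF gk' less_imp_le[OF lt]])
      also have "\<dots> = ?\<Delta> k / 2" using lt by (intro nonzero_eq_divide_eq[THEN iffD1]) auto
      finally have "\<not> 0 < ?\<Delta> k" by argo
      \<comment> \<open>At \<open>z = y k\<close> the left side of \<open>neg\<close>
        vanishes.\<close>
      moreover have "0 < ?\<Delta> k"
        using neg[of "y k"] y k by (auto simp: fine_tagged_def)
      ultimately show False by contradiction
    qed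
    then obtain z where z: "\<And>k. k \<in> {1..n} \<Longrightarrow> z k \<in> {x (k - 1)..x k}"
      "\<And>k. k \<in> {1..n} \<Longrightarrow> ?\<Delta> k \<le> 2 * (\<bar>g (y k) - g (z k)\<bar> * (x k - x (k - 1)))"
      by metis
    have "fine_tagged \<delta> a b n x z"
      using y z(1) by (auto simp: fine_tagged_def)
    have "(\<Sum>k=1..n. ?\<Delta> k) \<le> (\<Sum>k=1..n. 2 * (\<bar>g (y k) - g (z k)\<bar> * (x k - x (k - 1))))"
      using z(2) by (rule sum_mono)
    also have "\<dots> < \<epsilon>"
      using \<delta>(2)[OF y \<open>fine_tagged \<delta> a b n x z\<close>] by (simp flip: sum_distrib_left)
    finally show ?thesis .
  qed
  with \<delta>(1) show ?thesis by (rule that)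
qed

section \<open>Comparison of the two integrals\<close>

lemma has_RS_integral_transfer:
  assumes close: "\<And>\<epsilon>. \<epsilon> > 0 \<Longrightarrow> \<exists>\<delta>>0. \<forall>n x y. fine_tagged \<delta> a b n x y \<longrightarrow>
      \<bar>RS_sum u v n x y - RS_sum u' v' n x y\<bar> < \<epsilon>"
    and I: "has_RS_integral u v a b I"
  shows "has_RS_integral u' v' a b I"
  unfolding has_RS_integral_iff
proof (intro allI impI)
  fix \<epsilon> :: real assume "\<epsilon> > 0"
  then obtain d where d: "d > 0" "\<And>n x y. fine_tagged d a b n x y \<Longrightarrow>
      \<bar>RS_sum u v n x y - I\<bar> < \<epsilon> / 2"
    using has_RS_integralE[OF I, of "\<epsilon> / 2"] by auto
  obtain e where e: "e > 0" "\<And>n x y. fine_tagged e a b n x y \<Longrightarrow>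
      \<bar>RS_sum u v n x y - RS_sum u' v' n x y\<bar> < \<epsilon> / 2"
    using close[of "\<epsilon> / 2"] \<open>\<epsilon> > 0\<close> by auto
  have "\<bar>RS_sum u' v' n x y - I\<bar> < \<epsilon>" if "fine_tagged (min d e) a b n x y" for n x y
    using d(2)[OF fine_tagged_mono[OF that min.cobounded1]]
      e(2)[OF fine_tagged_mono[OF that min.cobounded2]] by linarith
  then show "\<exists>\<delta>>0. \<forall>n x y. fine_tagged \<delta> a b n x y \<longrightarrow> \<bar>RS_sum u' v' n x y - I\<bar> < \<epsilon>"
    using d(1) e(1) by (intro exI[of _ "min d e"]) auto
qed

text \<open>The two sums differ by a combination of the errors of the preceding estimate with the
  values of \<open>f\<close> at the tags as weights. Their signs are arbitrary, which is why that
  estimate has the absolute values inside the sum. As \<open>I\<close> is arbitrary, both the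
  equivalence of integrability and the equality of the integrals follow.\<close>

lemma has_RS_integral_indefinite_integral_iff:
  assumes f: "bounded (f ` {a..b})"
    and g: "riemann_integrable g a b"
    and G: "\<And>x. x \<in> {a..b} \<Longrightarrow> G x = c + riemann_integral g a x"
  shows "has_RS_integral f G a b I \<longleftrightarrow> has_RS_integral (\<lambda>x. f x * g x) (\<lambda>x. x) a b I"
proof -
  obtain M where M: "M > 0" "\<And>z. z \<in> {a..b} \<Longrightarrow> \<bar>f z\<bar> \<le> M"
    using f unfolding bounded_pos by auto
  have close: "\<exists>\<delta>>0. \<forall>n x y. fine_tagged \<delta> a b n x y \<longrightarrow>
      \<bar>RS_sum (\<lambda>x. f x * g x) (\<lambda>x. x) n x y - RS_sum f G n x y\<bar> < \<epsilon>" if "\<epsilon> > 0" for \<epsilon>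
  proof -
    \<comment> \<open>Dividing by \<open>M\<close> offsets the bound on the weights
      \<open>f (y k)\<close>.\<close>
    have "\<epsilon> / M > 0" using M(1) \<open>\<epsilon> > 0\<close> by simp
    then obtain \<delta> where \<delta>: "\<delta> > 0" "\<And>n x y. fine_tagged \<delta> a b n x y \<Longrightarrow>
       (\<Sum>k=1..n. \<bar>g (y k) * (x k - x (k - 1)) - (G (x k) - G (x (k - 1)))\<bar>) < \<epsilon> / M"
      using riemann_sum_indefinite_integral_diff[OF g G] by blast
    have "\<bar>RS_sum (\<lambda>x. f x * g x) (\<lambda>x. x) n x y - RS_sum f G n x y\<bar> < \<epsilon>"
      if y: "fine_tagged \<delta> a b n x y" for n x y
    proof -
      let ?\<Delta> = "\<lambda>k. g (y k) * (x k - x (k - 1)) - (G (x k) - G (x (k - 1)))"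
      have "RS_sum (\<lambda>x. f x * g x) (\<lambda>x. x) n x y - RS_sum f G n x y = (\<Sum>k=1..n. f (y k) * ?\<Delta> k)"
        unfolding RS_sum_def sum_subtractf[symmetric]
        by (intro sum.cong) (simp_all add: algebra_simps)
      also have "\<bar>\<dots>\<bar> \<le> (\<Sum>k=1..n. M * \<bar>?\<Delta> k\<bar>)"
        using M(2)[OF fine_tagged_tag_in_interval[OF y]]
        by (intro order_trans[OF sum_abs] sum_mono) (simp add: abs_mult mult_right_mono)
      also have "\<dots> < \<epsilon>"
        using \<delta>(2)[OF y] M(1) by (simp add: pos_less_divide_eq mult.commute flip: sum_distrib_left)
      finally show ?thesis .
    qed
    with \<delta>(1) show ?thesis by blast
  qed
  then have close': "\<exists>\<delta>>0. \<forall>n x y. fine_tagged \<delta> a b n x y \<longrightarrow>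
      \<bar>RS_sum f G n x y - RS_sum (\<lambda>x. f x * g x) (\<lambda>x. x) n x y\<bar> < \<epsilon>" if "\<epsilon> > 0" for \<epsilon>
    using that by (simp add: abs_minus_commute)
  show ?thesis
    using has_RS_integral_transfer[OF close'] has_RS_integral_transfer[OF close] by (rule iffI)
qed

theorem theorem1p1:
  fixes a b c :: real and f g G :: "real \<Rightarrow> real"
  assumes "a < b"
    and "bounded (f ` {a..b})"
    and "riemann_integrable g a b"
    and "\<And>x. x \<in> {a..b} \<Longrightarrow> G x = c + riemann_integral g a x"
  shows "(RS_integrable f G a b \<longleftrightarrow> riemann_integrable (\<lambda>x. f x * g x) a b) \<and>
    (RS_integrable f G a b \<longrightarrow>
      RS_integral f G a b = riemann_integral (\<lambda>x. f x * g x) a b)"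
  using has_RS_integral_indefinite_integral_iff[OF assms(2-4)]
  by (simp add: RS_integrable_def riemann_integrable_def RS_integral_def riemann_integral_def)

end
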